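(* Let $X$ be a compactum. Then $\prod_u^{\omega}X$ is first countable if and only if $X$ is $\omega$-monolithic and every separable closed subspace of $X$ is a $G_\delta$ subset of $X$.
   Context: A compactum is a compact Hausdorff space. A space $X$ is $\omega$-monolithic if each separable subset (subspace) of $X$ is metrizable. Countable uniform power: let $X$ be compact and let $\mathfrak{U}$ be its unique compatible uniformity. For $U\in\mathfrak{U}$ let $\widetilde U=\{\langle f,g\rangle: f,g\in {}^{\omega}X,\ \forall n<\omega\ \langle f(n),g(n)\rangle\in U\}$. The sets $\widetilde U$, $U\in\mathfrak{U}$, form a base of a uniformity on ${}^{\omega}X$, and $\prod_u^{\omega}X$ is the set ${}^{\omega}X$ with the topology generated by this uniformity. *)

theory Defs
  imports "HOL-Analysis.Analysis"
begin

section \<open>Uniformities on a carrier set\<close>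

text \<open>
  The type class \<open>uniform_space\<close> attaches one uniformity to a whole type. Compacta are
  treated here as abstract topologies, so entourages live on a carrier set \<open>S\<close>.
\<close>

definition is_uniformity :: "'a set \<Rightarrow> ('a \<times> 'a) set set \<Rightarrow> bool" where
  "is_uniformity S \<UU> \<longleftrightarrow>
     S \<times> S \<in> \<UU> \<and>
     (\<forall>U\<in>\<UU>. U \<subseteq> S \<times> S \<and> Id_on S \<subseteq> U) \<and>
     (\<forall>U\<in>\<UU>. \<forall>V. U \<subseteq> V \<and> V \<subseteq> S \<times> S \<longrightarrow> V \<in> \<UU>) \<and>
     (\<forall>U\<in>\<UU>. \<forall>V\<in>\<UU>. U \<inter> V \<in> \<UU>) \<and>
     (\<forall>U\<in>\<UU>. U\<inverse> \<in> \<UU>) \<and>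
     (\<forall>U\<in>\<UU>. \<exists>V\<in>\<UU>. V O V \<subseteq> U)"

definition uniformity_from_base :: "'a set \<Rightarrow> ('a \<times> 'a) set set \<Rightarrow> ('a \<times> 'a) set set" where
  "uniformity_from_base S \<B> = {V. V \<subseteq> S \<times> S \<and> (\<exists>U\<in>\<B>. U \<subseteq> V)}"

definition uniform_topology :: "'a set \<Rightarrow> ('a \<times> 'a) set set \<Rightarrow> 'a topology" where
  "uniform_topology S \<UU> = topology (\<lambda>W. W \<subseteq> S \<and> (\<forall>x\<in>W. \<exists>U\<in>\<UU>. U `` {x} \<subseteq> W))"

definition compatible_uniformity :: "'a topology \<Rightarrow> ('a \<times> 'a) set set \<Rightarrow> bool" where
  "compatible_uniformity X \<UU> \<longleftrightarrow>
     is_uniformity (topspace X) \<UU> \<and> uniform_topology (topspace X) \<UU> = X"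

text \<open>
  Meaningful for compact Hausdorff \<open>X\<close> only; see \<open>ex1_compatible_uniformity\<close> below.
\<close>

definition the_uniformity :: "'a topology \<Rightarrow> ('a \<times> 'a) set set" where
  "the_uniformity X = (THE \<UU>. compatible_uniformity X \<UU>)"


section \<open>The countable uniform power and monolithicity\<close>

definition power_entourage :: "'a set \<Rightarrow> ('a \<times> 'a) set \<Rightarrow> ((nat \<Rightarrow> 'a) \<times> (nat \<Rightarrow> 'a)) set" where
  "power_entourage S U =
     {(f, g). f \<in> UNIV \<rightarrow> S \<and> g \<in> UNIV \<rightarrow> S \<and> (\<forall>n. (f n, g n) \<in> U)}"

definition uniform_power :: "'a topology \<Rightarrow> (nat \<Rightarrow> 'a) topology" where
  "uniform_power X =
     uniform_topology (UNIV \<rightarrow> topspace X)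
       (uniformity_from_base (UNIV \<rightarrow> topspace X)
          (power_entourage (topspace X) ` the_uniformity X))"

definition omega_monolithic :: "'a topology \<Rightarrow> bool" where
  "omega_monolithic X \<longleftrightarrow>
     (\<forall>S. S \<subseteq> topspace X \<and> separable_space (subtopology X S)
          \<longrightarrow> metrizable_space (subtopology X S))"


section \<open>Well-definedness\<close>

lemma is_uniformityD:
  assumes "is_uniformity S \<UU>"
  shows "S \<times> S \<in> \<UU>"
    and "U \<in> \<UU> \<Longrightarrow> U \<subseteq> S \<times> S"
    and "U \<in> \<UU> \<Longrightarrow> x \<in> S \<Longrightarrow> (x, x) \<in> U"
    and "U \<in> \<UU> \<Longrightarrow> U \<subseteq> V \<Longrightarrow> V \<subseteq> S \<times> S \<Longrightarrow> V \<in> \<UU>"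
    and "U \<in> \<UU> \<Longrightarrow> V \<in> \<UU> \<Longrightarrow> U \<inter> V \<in> \<UU>"
    and "U \<in> \<UU> \<Longrightarrow> U\<inverse> \<in> \<UU>"
    and "U \<in> \<UU> \<Longrightarrow> \<exists>V\<in>\<UU>. V O V \<subseteq> U"
proof -
  note 0 = assms[unfolded is_uniformity_def]
  note 1 = conjunct1[OF 0] and r1 = conjunct2[OF 0]
  note 2 = conjunct1[OF r1] and r2 = conjunct2[OF r1]
  note 3 = conjunct1[OF r2] and r3 = conjunct2[OF r2]
  note 4 = conjunct1[OF r3] and r4 = conjunct2[OF r3]
  note 5 = conjunct1[OF r4] and 6 = conjunct2[OF r4]
  show "S \<times> S \<in> \<UU>" by (rule 1)
  show "U \<subseteq> S \<times> S" if "U \<in> \<UU>" using bspec[OF 2 that] by (rule conjunct1)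
  show "(x, x) \<in> U" if "U \<in> \<UU>" "x \<in> S" using bspec[OF 2 that(1)] that(2) by auto
  show "V \<in> \<UU>" if "U \<in> \<UU>" "U \<subseteq> V" "V \<subseteq> S \<times> S"
    using bspec[OF 3 that(1)] that(2,3) by simp
  show "U \<inter> V \<in> \<UU>" if "U \<in> \<UU>" "V \<in> \<UU>" using bspec[OF bspec[OF 4 that(1)] that(2)] .
  show "U\<inverse> \<in> \<UU>" if "U \<in> \<UU>" using bspec[OF 5 that] .
  show "\<exists>V\<in>\<UU>. V O V \<subseteq> U" if "U \<in> \<UU>" using bspec[OF 6 that] .
qed

lemma openin_uniform_topology:
  assumes "is_uniformity S \<UU>"
  shows "openin (uniform_topology S \<UU>) W \<longleftrightarrow>
           W \<subseteq> S \<and> (\<forall>x\<in>W. \<exists>U\<in>\<UU>. U `` {x} \<subseteq> W)"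
proof -
  define P where "P W \<longleftrightarrow> W \<subseteq> S \<and> (\<forall>x\<in>W. \<exists>U\<in>\<UU>. U `` {x} \<subseteq> W)" for W
  have "P (A \<inter> B)" if A: "P A" and B: "P B" for A B
    unfolding P_def
  proof (intro conjI ballI)
    show "A \<inter> B \<subseteq> S" using A unfolding P_def by auto
    fix x assume x: "x \<in> A \<inter> B"
    obtain U where U: "U \<in> \<UU>" "U `` {x} \<subseteq> A" using A x unfolding P_def by auto
    obtain V where V: "V \<in> \<UU>" "V `` {x} \<subseteq> B" using B x unfolding P_def by auto
    have "U \<inter> V \<in> \<UU>" using is_uniformityD(5)[OF assms U(1) V(1)] .
    moreover have "(U \<inter> V) `` {x} \<subseteq> A \<inter> B" using U(2) V(2) by auto
    ultimately show "\<exists>U\<in>\<UU>. U `` {x} \<subseteq> A \<inter> B" by (rule bexI[rotated])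
  qed
  moreover have "P (\<Union>\<K>)" if K: "\<forall>A\<in>\<K>. P A" for \<K>
    unfolding P_def
  proof (intro conjI ballI)
    show "\<Union>\<K> \<subseteq> S" using K unfolding P_def by auto
    fix x assume "x \<in> \<Union>\<K>"
    then obtain A where A: "A \<in> \<K>" "x \<in> A" by auto
    then have "\<exists>U\<in>\<UU>. U `` {x} \<subseteq> A" using K unfolding P_def by simp
    moreover have "A \<subseteq> \<Union>\<K>" using A(1) by auto
    ultimately show "\<exists>U\<in>\<UU>. U `` {x} \<subseteq> \<Union>\<K>" by (meson order_trans)
  qed
  ultimately have "istopology P" unfolding istopology_def by simp
  then have "openin (topology P) W \<longleftrightarrow> P W" by (simp add: topology_inverse')
  then show ?thesis unfolding uniform_topology_def P_def .
qed

lemma topspace_uniform_topology: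
  assumes "is_uniformity S \<UU>"
  shows "topspace (uniform_topology S \<UU>) = S"
proof -
  have "openin (uniform_topology S \<UU>) S"
    using openin_uniform_topology[OF assms] is_uniformityD(1,2)[OF assms] by blast
  then show ?thesis
    using openin_uniform_topology[OF assms] by (meson openin_subset openin_topspace subset_antisym)
qed

lemma uniform_nbhd:
  assumes u: "is_uniformity S \<UU>" and V: "V \<in> \<UU>" and x: "x \<in> S"
  obtains N where "openin (uniform_topology S \<UU>) N" "x \<in> N" "N \<subseteq> V `` {x}"
proof -
  define N where "N = {y \<in> S. \<exists>U\<in>\<UU>. U `` {y} \<subseteq> V `` {x}}"
  have "\<exists>D\<in>\<UU>. D `` {y} \<subseteq> N" if y: "y \<in> N" for y
  proof -
    obtain U where U: "U \<in> \<UU>" "U `` {y} \<subseteq> V `` {x}" using y unfolding N_def by auto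
    obtain D where D: "D \<in> \<UU>" "D O D \<subseteq> U" using is_uniformityD(7)[OF u U(1)] by auto
    have "z \<in> N" if z: "(y, z) \<in> D" for z
    proof -
      have "z \<in> S" using z is_uniformityD(2)[OF u D(1)] by auto
      moreover have "D `` {z} \<subseteq> V `` {x}"
      proof
        fix w assume "w \<in> D `` {z}"
        then have "(y, w) \<in> U" using z D(2) by auto
        then show "w \<in> V `` {x}" using U(2) by auto
      qed
      ultimately show ?thesis using D(1) unfolding N_def by auto
    qed
    then have "D `` {y} \<subseteq> N" by auto
    then show ?thesis using D(1) by auto
  qed
  then have "openin (uniform_topology S \<UU>) N"
    unfolding openin_uniform_topology[OF u] by (auto simp: N_def)
  moreover have "x \<in> N" using x V unfolding N_def by auto
  moreover have "N \<subseteq> V `` {x}"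
  proof
    fix y assume "y \<in> N"
    then obtain U where "y \<in> S" "U \<in> \<UU>" "U `` {y} \<subseteq> V `` {x}" unfolding N_def by auto
    then show "y \<in> V `` {x}" using is_uniformityD(3)[OF u, of U y] by auto
  qed
  ultimately show ?thesis by (rule that)
qed

lemma uniformity_Inter:
  assumes u: "is_uniformity S \<UU>" and "finite F" "\<And>x. x \<in> F \<Longrightarrow> D x \<in> \<UU>"
  shows "(S \<times> S) \<inter> (\<Inter>x\<in>F. D x) \<in> \<UU>"
  using assms(2,3)
proof (induction F)
  case empty
  then show ?case using is_uniformityD(1)[OF u] by simp
next
  case (insert a F)
  have "D a \<inter> ((S \<times> S) \<inter> (\<Inter>x\<in>F. D x)) \<in> \<UU>"
    by (rule is_uniformityD(5)[OF u]) (use insert in auto)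
  then show ?case by (simp add: Int_ac)
qed

lemma compatible_uniformity_subset_nbhds:
  assumes c: "compatible_uniformity X \<VV>" and V: "V \<in> \<VV>"
  shows "\<exists>W. openin (prod_topology X X) W \<and> Id_on (topspace X) \<subseteq> W \<and> W \<subseteq> V"
proof -
  have u: "is_uniformity (topspace X) \<VV>" and X: "uniform_topology (topspace X) \<VV> = X"
    using c unfolding compatible_uniformity_def by auto
  obtain D where D: "D \<in> \<VV>" "D O D \<subseteq> V" using is_uniformityD(7)[OF u V] by blast
  define E where "E = D \<inter> D\<inverse>"
  have E: "E \<in> \<VV>" using D(1) is_uniformityD(5,6)[OF u] unfolding E_def by blast
  have "\<exists>N. openin X N \<and> x \<in> N \<and> N \<subseteq> E `` {x}" if "x \<in> topspace X" for x
    by (rule uniform_nbhd[OF u E that, unfolded X]) blast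
  then obtain N where N: "\<And>x. x \<in> topspace X \<Longrightarrow> openin X (N x) \<and> x \<in> N x \<and> N x \<subseteq> E `` {x}"
    by metis
  have "openin (prod_topology X X) (\<Union>x\<in>topspace X. N x \<times> N x)"
    using N by (intro openin_Union) (auto simp: openin_prod_Times_iff)
  moreover have "Id_on (topspace X) \<subseteq> (\<Union>x\<in>topspace X. N x \<times> N x)"
    using N by auto
  moreover have "N x \<times> N x \<subseteq> V" if "x \<in> topspace X" for x
  proof clarify
    fix a b assume "a \<in> N x" "b \<in> N x"
    then have "(a, x) \<in> D" "(x, b) \<in> D" using N[OF that] unfolding E_def by auto
    then show "(a, b) \<in> V" using D(2) by auto
  qed
  then have "(\<Union>x\<in>topspace X. N x \<times> N x) \<subseteq> V" by (rule UN_least)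
  ultimately show ?thesis by (intro exI conjI)
qed

lemma compatible_uniformity_supset_nbhds:
  assumes K: "compact_space X" and c: "compatible_uniformity X \<VV>"
    and W: "openin (prod_topology X X) W" "Id_on (topspace X) \<subseteq> W" "W \<subseteq> U"
    and U: "U \<subseteq> topspace X \<times> topspace X"
  shows "U \<in> \<VV>"
proof -
  have u: "is_uniformity (topspace X) \<VV>" and X: "uniform_topology (topspace X) \<VV> = X"
    using c unfolding compatible_uniformity_def by auto
  have op: "openin X A \<longleftrightarrow> A \<subseteq> topspace X \<and> (\<forall>x\<in>A. \<exists>U\<in>\<VV>. U `` {x} \<subseteq> A)" for A
    using openin_uniform_topology[OF u] X by simp
  have "\<exists>D O'. D \<in> \<VV> \<and> (D O D) `` {x} \<times> (D O D) `` {x} \<subseteq> W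
          \<and> openin X O' \<and> x \<in> O' \<and> O' \<subseteq> D `` {x}"
    if x: "x \<in> topspace X" for x
  proof -
    have "(x, x) \<in> W" using W(2) x by blast
    then obtain A B where AB: "openin X A" "openin X B" "x \<in> A" "x \<in> B" "A \<times> B \<subseteq> W"
      using W(1) unfolding openin_prod_topology_alt by meson
    have "openin X (A \<inter> B)" using AB by blast
    then obtain V where V: "V \<in> \<VV>" "V `` {x} \<subseteq> A \<inter> B" using AB(3,4) op by (metis IntI)
    obtain D where D: "D \<in> \<VV>" "D O D \<subseteq> V" using is_uniformityD(7)[OF u V(1)] by blast
    obtain O' where "openin X O'" "x \<in> O'" "O' \<subseteq> D `` {x}"
      by (rule uniform_nbhd[OF u D(1) x, unfolded X])
    moreover have "(D O D) `` {x} \<times> (D O D) `` {x} \<subseteq> W" using D(2) V(2) AB(5) by blast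
    ultimately show ?thesis using D(1) by blast
  qed
  then obtain D N where DN: "\<And>x. x \<in> topspace X \<Longrightarrow> D x \<in> \<VV>
      \<and> (D x O D x) `` {x} \<times> (D x O D x) `` {x} \<subseteq> W
      \<and> openin X (N x) \<and> x \<in> N x \<and> N x \<subseteq> D x `` {x}"
    by metis
  have "\<exists>\<F>. finite \<F> \<and> \<F> \<subseteq> N ` topspace X \<and> topspace X \<subseteq> \<Union>\<F>"
    using K unfolding compact_space_alt
    by (rule allE[of _ "N ` topspace X"]) (use DN in blast)
  then obtain F where F: "finite F" "F \<subseteq> topspace X" "topspace X \<subseteq> \<Union>(N ` F)"
    by (metis finite_subset_image)
  let ?E = "(topspace X \<times> topspace X) \<inter> (\<Inter>x\<in>F. D x)"
  have E: "?E \<in> \<VV>" using F DN by (intro uniformity_Inter[OF u]) auto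
  have "?E \<subseteq> W"
  proof clarify
    fix a b assume ab: "a \<in> topspace X" "b \<in> topspace X" "(a, b) \<in> (\<Inter>x\<in>F. D x)"
    obtain x where x: "x \<in> F" "a \<in> N x" using F(3) ab(1) by blast
    have xS: "x \<in> topspace X" using x F(2) by blast
    have "(x, a) \<in> D x" "(a, b) \<in> D x" using DN[OF xS] x ab(3) by blast+
    moreover have "(a, a) \<in> D x" using DN[OF xS] ab(1) is_uniformityD(3)[OF u] by blast
    ultimately have "a \<in> (D x O D x) `` {x}" "b \<in> (D x O D x) `` {x}" by blast+
    then show "(a, b) \<in> W" using DN[OF xS] by blast
  qed
  then show ?thesis using is_uniformityD(4)[OF u E _ U] W(3) by blast
qed

lemma nbhds_of_diagonal_compatible:
  assumes K: "compact_space X" and H: "Hausdorff_space X"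
  shows "compatible_uniformity X {U. U \<subseteq> topspace X \<times> topspace X \<and>
           (\<exists>W. openin (prod_topology X X) W \<and> Id_on (topspace X) \<subseteq> W \<and> W \<subseteq> U)}"
    (is "compatible_uniformity X ?\<UU>")
proof -
  let ?S = "topspace X"
  have reg: "regular_space X" using compact_Hausdorff_imp_regular_space K H by blast
  have opU: "U \<in> ?\<UU>" if "openin (prod_topology X X) U" "Id_on ?S \<subseteq> U" for U
    using that openin_subset[OF that(1)] by auto
  have half: "\<exists>V\<in>?\<UU>. V O V \<subseteq> U" if U: "U \<in> ?\<UU>" for U
  proof -
    obtain W where W: "openin (prod_topology X X) W" "Id_on ?S \<subseteq> W" "W \<subseteq> U" using U by blast
    have "\<exists>A B C. openin X A \<and> openin X B \<and> closedin X C \<and> x \<in> B \<and> B \<subseteq> C \<and> C \<subseteq> A \<and> A \<times> A \<subseteq> W"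
      if x: "x \<in> ?S" for x
    proof -
      have "(x, x) \<in> W" using W(2) x by blast
      then obtain A A' where A: "openin X A" "openin X A'" "x \<in> A" "x \<in> A'" "A \<times> A' \<subseteq> W"
        using W(1) unfolding openin_prod_topology_alt by meson
      have "openin X (A \<inter> A')" using A by blast
      moreover have "neighbourhood_base_of (closedin X) X"
        using reg neighbourhood_base_of_closedin by blast
      ultimately obtain B C where "openin X B" "closedin X C" "x \<in> B" "B \<subseteq> C" "C \<subseteq> A \<inter> A'"
        using A(3,4) unfolding neighbourhood_base_of by (metis IntI)
      moreover have "(A \<inter> A') \<times> (A \<inter> A') \<subseteq> W" using A(5) by blast
      ultimately show ?thesis using \<open>openin X (A \<inter> A')\<close> by blast
    qed
    then obtain A B C where ABC: "\<And>x. x \<in> ?S \<Longrightarrow> openin X (A x) \<and> openin X (B x)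
        \<and> closedin X (C x) \<and> x \<in> B x \<and> B x \<subseteq> C x \<and> C x \<subseteq> A x \<and> A x \<times> A x \<subseteq> W"
      by metis
    have "\<exists>\<F>. finite \<F> \<and> \<F> \<subseteq> B ` ?S \<and> ?S \<subseteq> \<Union>\<F>"
      using K unfolding compact_space_alt
      by (rule allE[of _ "B ` ?S"]) (use ABC in blast)
    then obtain F where F: "finite F" "F \<subseteq> ?S" "?S \<subseteq> \<Union>(B ` F)"
      by (metis finite_subset_image)
    define G where "G x = A x \<times> A x \<union> (?S - C x) \<times> (?S - C x)" for x
    let ?V = "(?S \<times> ?S) \<inter> (\<Inter>x\<in>F. G x)"
    have oG: "openin (prod_topology X X) (G x)" if "x \<in> F" for x
    proof -
      have "x \<in> ?S" using F(2) that by blast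
      then have "openin X (A x)" "openin X (?S - C x)"
        using ABC openin_diff[OF openin_topspace] by blast+
      then show ?thesis
        unfolding G_def by (intro openin_Un) (simp_all add: openin_prod_Times_iff)
    qed
    have "openin (prod_topology X X) ((?S \<times> ?S) \<inter> (\<Inter>x\<in>F'. G x))" if "finite F'" "F' \<subseteq> F" for F'
      using that
    proof (induction F')
      case empty
      then show ?case by (simp add: openin_prod_Times_iff)
    next
      case (insert a F')
      have "openin (prod_topology X X) (G a \<inter> ((?S \<times> ?S) \<inter> (\<Inter>x\<in>F'. G x)))"
        by (rule openin_Int) (use insert oG in auto)
      then show ?case by (simp add: Int_ac)
    qed
    then have "openin (prod_topology X X) ?V" using F(1) by blast
    moreover have "Id_on ?S \<subseteq> ?V"
      unfolding G_def using ABC F(2) by blast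
    ultimately have "?V \<in> ?\<UU>" by (rule opU)
    moreover have "?V O ?V \<subseteq> U"
    proof clarify
      fix a b c
      assume b: "b \<in> ?S" and ab: "(a, b) \<in> (\<Inter>x\<in>F. G x)" and bc: "(b, c) \<in> (\<Inter>x\<in>F. G x)"
      obtain x where x: "x \<in> F" "b \<in> B x" using F(3) b by blast
      have xS: "x \<in> ?S" using x F(2) by blast
      have "b \<in> C x" using ABC[OF xS] x by blast
      then have "a \<in> A x" "c \<in> A x" using ab bc x(1) unfolding G_def by blast+
      then show "(a, c) \<in> U" using ABC[OF xS] W(3) by blast
    qed
    ultimately show ?thesis by blast
  qed
  have conv: "U\<inverse> \<in> ?\<UU>" if U: "U \<in> ?\<UU>" for U
  proof -
    obtain W where W: "openin (prod_topology X X) W" "Id_on ?S \<subseteq> W" "W \<subseteq> U" using U by auto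
    have "openin (prod_topology X X) (W\<inverse>)"
      unfolding openin_prod_topology_alt
    proof (intro allI impI)
      fix x y assume "(x, y) \<in> W\<inverse>"
      then have "(y, x) \<in> W" by simp
      then obtain P Q where "openin X P" "openin X Q" "y \<in> P" "x \<in> Q" "P \<times> Q \<subseteq> W"
        using W(1) unfolding openin_prod_topology_alt by meson
      moreover from this have "Q \<times> P \<subseteq> W\<inverse>" by auto
      ultimately show "\<exists>U V. openin X U \<and> openin X V \<and> x \<in> U \<and> y \<in> V \<and> U \<times> V \<subseteq> W\<inverse>"
        by (intro exI conjI)
    qed
    moreover have "Id_on ?S \<subseteq> W\<inverse>" "W\<inverse> \<subseteq> U\<inverse>" "U\<inverse> \<subseteq> ?S \<times> ?S" using U W(2,3) by auto
    ultimately show ?thesis by (intro CollectI conjI exI)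
  qed
  have int: "U \<inter> V \<in> ?\<UU>" if UV: "U \<in> ?\<UU>" "V \<in> ?\<UU>" for U V
  proof -
    obtain W where W: "openin (prod_topology X X) W" "Id_on ?S \<subseteq> W" "W \<subseteq> U"
      using UV(1) by auto
    obtain W' where W': "openin (prod_topology X X) W'" "Id_on ?S \<subseteq> W'" "W' \<subseteq> V"
      using UV(2) by auto
    have "openin (prod_topology X X) (W \<inter> W')" using W(1) W'(1) by (rule openin_Int)
    moreover have "Id_on ?S \<subseteq> W \<inter> W'" "W \<inter> W' \<subseteq> U \<inter> V" "U \<inter> V \<subseteq> ?S \<times> ?S"
      using W(2,3) W'(2,3) UV by auto
    ultimately show ?thesis by (intro CollectI conjI exI)
  qed
  have top: "?S \<times> ?S \<in> ?\<UU>" by (rule opU) (auto simp: openin_prod_Times_iff)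
  have u: "is_uniformity ?S ?\<UU>"
    unfolding is_uniformity_def
  proof (intro conjI)
    show "?S \<times> ?S \<in> ?\<UU>" by (rule top)
    show "\<forall>U\<in>?\<UU>. U \<subseteq> ?S \<times> ?S \<and> Id_on ?S \<subseteq> U" by auto
    show "\<forall>U\<in>?\<UU>. \<exists>V\<in>?\<UU>. V O V \<subseteq> U" by (rule ballI) (rule half)
    show "\<forall>U\<in>?\<UU>. U\<inverse> \<in> ?\<UU>" by (rule ballI) (rule conv)
    show "\<forall>U\<in>?\<UU>. \<forall>V\<in>?\<UU>. U \<inter> V \<in> ?\<UU>" by (intro ballI) (rule int)
    show "\<forall>U\<in>?\<UU>. \<forall>V. U \<subseteq> V \<and> V \<subseteq> ?S \<times> ?S \<longrightarrow> V \<in> ?\<UU>"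
      by (fastforce intro: order_trans)
  qed
  have "openin (uniform_topology ?S ?\<UU>) A \<longleftrightarrow> openin X A" for A
  proof
    assume A: "openin (uniform_topology ?S ?\<UU>) A"
    show "openin X A"
    proof (subst openin_subopen, intro ballI)
      fix x assume x: "x \<in> A"
      have xS: "x \<in> ?S" using A x unfolding openin_uniform_topology[OF u] by blast
      obtain U where U: "U \<in> ?\<UU>" "U `` {x} \<subseteq> A"
        using A x unfolding openin_uniform_topology[OF u] by blast
      then obtain W where W: "openin (prod_topology X X) W" "Id_on ?S \<subseteq> W" "W \<subseteq> U" by blast
      have "(x, x) \<in> W" using W(2) xS by blast
      then obtain P Q where PQ: "openin X P" "openin X Q" "x \<in> P" "x \<in> Q" "P \<times> Q \<subseteq> W"
        using W(1) unfolding openin_prod_topology_alt by meson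
      have "Q \<subseteq> A" using PQ W(3) U(2) by blast
      then show "\<exists>T. openin X T \<and> x \<in> T \<and> T \<subseteq> A" using PQ by blast
    qed
  next
    assume A: "openin X A"
    show "openin (uniform_topology ?S ?\<UU>) A"
      unfolding openin_uniform_topology[OF u]
    proof (intro conjI ballI)
      show "A \<subseteq> ?S" using A by (rule openin_subset)
      fix x assume x: "x \<in> A"
      let ?U = "A \<times> A \<union> (?S - {x}) \<times> (?S - {x})"
      have "openin X (?S - {x})"
        using H x A Hausdorff_imp_t1_space t1_space_openin_delete_alt openin_topspace
        by metis
      then have "openin (prod_topology X X) ?U"
        using A by (intro openin_Un) (auto simp: openin_prod_Times_iff)
      moreover have "Id_on ?S \<subseteq> ?U" using x by blast
      ultimately have "?U \<in> ?\<UU>" by (rule opU)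
      then show "\<exists>U\<in>?\<UU>. U `` {x} \<subseteq> A" by (rule bexI[rotated]) blast
    qed
  qed
  then show ?thesis
    unfolding compatible_uniformity_def using u by (simp add: topology_eq)
qed

theorem ex1_compatible_uniformity:
  assumes "compact_space X" "Hausdorff_space X"
  shows "\<exists>!\<UU>. compatible_uniformity X \<UU>"
proof -
  let ?\<UU> = "{U. U \<subseteq> topspace X \<times> topspace X \<and>
     (\<exists>W. openin (prod_topology X X) W \<and> Id_on (topspace X) \<subseteq> W \<and> W \<subseteq> U)}"
  have "\<VV> = ?\<UU>" if c: "compatible_uniformity X \<VV>" for \<VV>
  proof (intro subset_antisym subsetI)
    fix V assume V: "V \<in> \<VV>"
    then have "V \<subseteq> topspace X \<times> topspace X"
      using c is_uniformityD(2) unfolding compatible_uniformity_def by blast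
    then show "V \<in> ?\<UU>" using compatible_uniformity_subset_nbhds[OF c V] by blast
  next
    fix U assume "U \<in> ?\<UU>"
    then show "U \<in> \<VV>" using compatible_uniformity_supset_nbhds[OF assms(1) c] by blast
  qed
  then show ?thesis using nbhds_of_diagonal_compatible[OF assms] by blast
qed

corollary compatible_the_uniformity:
  assumes "compact_space X" "Hausdorff_space X"
  shows "compatible_uniformity X (the_uniformity X)"
  unfolding the_uniformity_def by (rule theI'[OF ex1_compatible_uniformity[OF assms]])

theorem is_uniformity_power:
  assumes u: "is_uniformity S \<UU>"
  shows "is_uniformity (UNIV \<rightarrow> S)
           (uniformity_from_base (UNIV \<rightarrow> S) (power_entourage S ` \<UU>))"
    (is "is_uniformity ?P ?\<VV>")
proof -
  have mem: "V \<in> ?\<VV> \<longleftrightarrow> V \<subseteq> ?P \<times> ?P \<and> (\<exists>U\<in>\<UU>. power_entourage S U \<subseteq> V)" for V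
    unfolding uniformity_from_base_def by auto
  have sub: "power_entourage S U \<subseteq> ?P \<times> ?P" for U
    unfolding power_entourage_def by auto
  have comp: "power_entourage S U O power_entourage S U \<subseteq> power_entourage S (U O U)" for U
    unfolding power_entourage_def by auto
  have mono: "power_entourage S U \<subseteq> power_entourage S V" if "U \<subseteq> V" for U V
    using that unfolding power_entourage_def by auto
  have cv: "power_entourage S (U\<inverse>) = (power_entourage S U)\<inverse>" for U
    unfolding power_entourage_def by auto
  have int: "power_entourage S (U \<inter> V) = power_entourage S U \<inter> power_entourage S V" for U V
    unfolding power_entourage_def by auto
  have diag: "Id_on ?P \<subseteq> power_entourage S U" if "U \<in> \<UU>" for U
    using is_uniformityD(3)[OF u that] unfolding power_entourage_def by auto
  show ?thesis
    unfolding is_uniformity_def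
  proof (intro conjI ballI allI impI)
    show "?P \<times> ?P \<in> ?\<VV>" unfolding mem using is_uniformityD(1)[OF u] sub by blast
  next
    fix U assume "U \<in> ?\<VV>"
    then show "U \<subseteq> ?P \<times> ?P" "Id_on ?P \<subseteq> U" unfolding mem using diag by blast+
  next
    fix U V assume "U \<in> ?\<VV>" "U \<subseteq> V \<and> V \<subseteq> ?P \<times> ?P"
    then show "V \<in> ?\<VV>" unfolding mem by blast
  next
    fix U V assume "U \<in> ?\<VV>" "V \<in> ?\<VV>"
    then obtain U' V' where "U' \<in> \<UU>" "V' \<in> \<UU>" "power_entourage S U' \<subseteq> U" "power_entourage S V' \<subseteq> V"
      "U \<subseteq> ?P \<times> ?P" unfolding mem by blast
    then show "U \<inter> V \<in> ?\<VV>" unfolding mem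
      by (intro conjI bexI[of _ "U' \<inter> V'"]) (use int is_uniformityD(5)[OF u] in blast)+
  next
    fix U assume "U \<in> ?\<VV>"
    then obtain U' where U': "U' \<in> \<UU>" "power_entourage S U' \<subseteq> U" "U \<subseteq> ?P \<times> ?P" unfolding mem by blast
    have "power_entourage S (U'\<inverse>) \<subseteq> U\<inverse>" unfolding cv using U'(2) by blast
    then show "U\<inverse> \<in> ?\<VV>" unfolding mem using U'(3) is_uniformityD(6)[OF u U'(1)] by blast
    obtain D where D: "D \<in> \<UU>" "D O D \<subseteq> U'" using is_uniformityD(7)[OF u U'(1)] by blast
    have "power_entourage S D O power_entourage S D \<subseteq> U"
      using comp[of D] mono[OF D(2)] U'(2) by blast
    moreover have "power_entourage S D \<in> ?\<VV>" unfolding mem using D(1) sub by blast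
    ultimately show "\<exists>V\<in>?\<VV>. V O V \<subseteq> U" by blast
  qed
qed

end

theory Submission
  imports Defs
begin

text \<open>
  Both sides of the equivalence are conditions on the closed separable subspaces \<open>S\<close> of \<open>X\<close>,
  and both say that the diagonal \<open>\<Delta>\<^sub>S\<close> of \<open>S\<close> is a \<open>G\<^sub>\<delta>\<close> subset of the square \<open>X \<times> X\<close>.

  First countability of the power at a sequence \<open>f\<close> means that countably many entourages suffice,
  up to refinement, among the pairs whose first coordinate lies in the range of \<open>f\<close>, since
  \<open>f\<close> can be changed at one index at a time (\<open>first_countable_power_iff\<close>).

  This condition on \<open>D = range f\<close> is equivalent to \<open>\<Delta>\<^sub>S\<close> being \<open>G\<^sub>\<delta>\<close> in \<open>X \<times> X\<close> for
  \<open>S\<close> the closure of \<open>D\<close> (\<open>countably_based_along_iff_gdelta_diagonal\<close>). Given the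
  entourages, the sets of pairs \<open>(a, b)\<close> such that both \<open>a\<close> and \<open>b\<close> are close to a common point of
  \<open>D\<close> intersect in \<open>\<Delta>\<^sub>S\<close>. Conversely, a closed \<open>G\<^sub>\<delta>\<close> set in a compactum has a countable base
  of neighbourhoods, and a neighbourhood of \<open>\<Delta>\<^sub>S\<close> becomes an entourage after adding all pairs
  whose first coordinate lies outside \<open>S\<close>.

  Finally, \<open>\<Delta>\<^sub>S\<close> is \<open>G\<^sub>\<delta>\<close> in \<open>X \<times> X\<close> exactly when \<open>S\<close> is metrizable and \<open>G\<^sub>\<delta>\<close> in \<open>X\<close>
  (\<open>gdelta_in_Id_on_iff\<close>); metrizability comes from Sneider's theorem that a compactum with a
  \<open>G\<^sub>\<delta>\<close> diagonal is metrizable.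
\<close>

section \<open>Gdelta sets\<close>

lemma gdelta_in_continuous_map_preimage:
  assumes f: "continuous_map X Y f" and T: "gdelta_in Y T"
  shows "gdelta_in X {x \<in> topspace X. f x \<in> T}"
proof -
  obtain C where C: "\<And>n::nat. openin Y (C n)" "\<And>n. C (Suc n) \<subseteq> C n" "\<Inter>(range C) = T"
    using T unfolding gdelta_in_descending by blast
  define B where "B n = {x \<in> topspace X. f x \<in> C n}" for n
  have "openin X (B n)" for n
    unfolding B_def using openin_continuous_map_preimage[OF f C(1)] .
  moreover have "B (Suc n) \<subseteq> B n" for n
    using C(2) unfolding B_def by blast
  moreover have "\<Inter>(range B) = {x \<in> topspace X. f x \<in> T}"
    using C(3) unfolding B_def by auto
  ultimately show ?thesis
    unfolding gdelta_in_descending by blast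
qed

lemma gdelta_in_INT_openin:
  assumes "countable I" "I \<noteq> {}" "\<And>i. i \<in> I \<Longrightarrow> openin X (W i)"
  shows "gdelta_in X (\<Inter>i\<in>I. W i)"
  by (rule gdelta_in_Inter) (use assms open_imp_gdelta_in in auto)

lemma gdelta_in_Times:
  assumes "gdelta_in X S" "gdelta_in Y T"
  shows "gdelta_in (prod_topology X Y) (S \<times> T)"
proof -
  have "S \<times> T = {z \<in> topspace (prod_topology X Y). fst z \<in> S}
              \<inter> {z \<in> topspace (prod_topology X Y). snd z \<in> T}"
    using assms[THEN gdelta_in_subset] by auto
  then show ?thesis
    using gdelta_in_Int[OF gdelta_in_continuous_map_preimage[OF continuous_map_fst assms(1)]
        gdelta_in_continuous_map_preimage[OF continuous_map_snd assms(2)]]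
    by simp
qed

text \<open>
  In a compactum a closed \<open>G\<^sub>\<delta>\<close> set has a countable base of neighbourhoods: shrink the open sets
  that intersect in \<open>C\<close> to open sets \<open>V n\<close> whose closures still intersect in \<open>C\<close>; by compactness
  the finite intersections of the \<open>V n\<close> form such a base.
\<close>
lemma compact_Hausdorff_gdelta_imp_countable_nbhd_base:
  assumes K: "compact_space X" and H: "Hausdorff_space X"
    and C: "closedin X C" and G: "gdelta_in X C"
  obtains \<N> where "countable \<N>" "\<And>N. N \<in> \<N> \<Longrightarrow> openin X N \<and> C \<subseteq> N"
    "\<And>V. openin X V \<Longrightarrow> C \<subseteq> V \<Longrightarrow> \<exists>N\<in>\<N>. N \<subseteq> V"
proof -
  have nor: "normal_space X"
    using K H compact_Hausdorff_or_regular_imp_normal_space by blast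
  obtain W where W: "\<And>n::nat. openin X (W n)" "\<Inter>(range W) = C"
    using G unfolding gdelta_in_descending by blast
  have "\<exists>V. openin X V \<and> C \<subseteq> V \<and> X closure_of V \<subseteq> W n" for n
  proof -
    have "C \<subseteq> W n" using W(2) by blast
    then show ?thesis using nor C W(1) unfolding normal_space_alt by blast
  qed
  then obtain V where V: "\<And>n. openin X (V n) \<and> C \<subseteq> V n \<and> X closure_of V n \<subseteq> W n"
    by metis
  define N where "N F = topspace X \<inter> (\<Inter>n\<in>F. V n)" for F
  have opN: "openin X (N F)" if "finite F" for F
    using that
  proof (induction F)
    case empty
    show ?case by (simp add: N_def)
  next
    case (insert n F)
    have "N (insert n F) = V n \<inter> N F" by (auto simp: N_def)
    then show ?case using insert.IH V by (simp add: openin_Int)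
  qed
  show ?thesis
  proof
    show "countable (N ` {F. finite F})"
      by (intro countable_image countable_Collect_finite)
    fix M assume "M \<in> N ` {F. finite F}"
    then obtain F where F: "finite F" "M = N F" by blast
    have "C \<subseteq> N F" using V closedin_subset[OF C] unfolding N_def by blast
    then show "openin X M \<and> C \<subseteq> M" using opN F by simp
  next
    fix O' assume O': "openin X O'" "C \<subseteq> O'"
    \<comment> \<open>The closures of the \<open>V n\<close> have no common point outside \<open>O'\<close>; in terms of covers:\<close>
    define \<U> where "\<U> = insert O' (range (\<lambda>n. topspace X - X closure_of V n))"
    have "\<forall>U\<in>\<U>. openin X U"
      using O'(1) unfolding \<U>_def by auto
    moreover have "topspace X \<subseteq> \<Union>\<U>"
    proof
      fix x assume x: "x \<in> topspace X"
      show "x \<in> \<Union>\<U>"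
      proof (cases "x \<in> C")
        case True
        then show ?thesis using O'(2) unfolding \<U>_def by blast
      next
        case False
        then obtain n where "x \<notin> W n" using W(2) by blast
        then have "x \<in> topspace X - X closure_of V n" using V x by blast
        then show ?thesis unfolding \<U>_def by blast
      qed
    qed
    ultimately obtain \<F> where \<F>: "finite \<F>" "\<F> \<subseteq> \<U>" "topspace X \<subseteq> \<Union>\<F>"
      using K unfolding compact_space_alt by metis
    have "finite (\<F> - {O'})" "\<F> - {O'} \<subseteq> range (\<lambda>n. topspace X - X closure_of V n)"
      using \<F>(1,2) unfolding \<U>_def by auto
    then obtain F where F: "finite F" "\<F> - {O'} = (\<lambda>n. topspace X - X closure_of V n) ` F"
      by (meson finite_subset_image)
    have "N F \<subseteq> O'"
    proof
      fix x assume x: "x \<in> N F"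
      have "x \<in> X closure_of V n" if "n \<in> F" for n
      proof -
        have "V n \<subseteq> X closure_of V n" using V by (simp add: closure_of_subset openin_subset)
        then show ?thesis using that x unfolding N_def by blast
      qed
      then have "x \<notin> \<Union>(\<F> - {O'})" unfolding F(2) by blast
      then show "x \<in> O'" using \<F>(3) x unfolding N_def by blast
    qed
    then show "\<exists>M\<in>N ` {F. finite F}. M \<subseteq> O'" using F(1) by blast
  qed
qed

section \<open>Metrizability of compacta with a Gdelta diagonal\<close>

lemma Lindelof_space_fsigma_subtopology:
  assumes L: "Lindelof_space X" and S: "fsigma_in X S"
  shows "Lindelof_space (subtopology X S)"
proof -
  obtain \<K> where "countable \<K>" "\<K> \<subseteq> Collect (closedin X)" "\<Union>\<K> = S"
    using S unfolding fsigma_in_def union_of_def by blast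
  then show ?thesis
    using Lindelof_space_Union[of \<K> X] Lindelof_space_closedin_subtopology[OF L] by blast
qed

text \<open>
  Sneider's theorem. Off the diagonal, \<open>X \<times> X\<close> is \<open>\<sigma>\<close>-compact, hence Lindelof, so countably many
  continuous real functions already separate the points of \<open>X\<close>. Together they embed \<open>X\<close> into a
  countable power of the real line.
\<close>
lemma compact_Hausdorff_gdelta_diagonal_imp_metrizable:
  assumes K: "compact_space X" and H: "Hausdorff_space X"
    and G: "gdelta_in (prod_topology X X) (Id_on (topspace X))"
  shows "metrizable_space X"
proof -
  let ?XX = "prod_topology X X" and ?\<Delta> = "Id_on (topspace X)"
  let ?C = "topspace ?XX - ?\<Delta>"
  \<comment> \<open>\<open>nz f\<close> consists of the pairs separated by \<open>f\<close>.\<close>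
  define nz where "nz f = {z \<in> topspace ?XX. f (fst z) - f (snd z) \<in> - {0}}" for f :: "'a \<Rightarrow> real"
  define \<G> where "\<G> = {f. continuous_map X euclideanreal f}"
  have op: "openin ?XX (nz f)" if "f \<in> \<G>" for f
  proof -
    have f: "continuous_map X euclideanreal f" using that unfolding \<G>_def by simp
    have "continuous_map ?XX euclideanreal (\<lambda>z. f (fst z) - f (snd z))"
      by (intro continuous_map_diff continuous_map_compose[OF continuous_map_fst f, unfolded o_def]
          continuous_map_compose[OF continuous_map_snd f, unfolded o_def])
    then show ?thesis unfolding nz_def by (rule openin_continuous_map_preimage) auto
  qed
  have cr: "completely_regular_space X"
    using K H compact_Hausdorff_or_regular_imp_normal_space
      normal_imp_completely_regular_space by blast
  have cover: "?C \<subseteq> \<Union>(nz ` \<G>)"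
  proof
    fix z assume z: "z \<in> ?C"
    then obtain x y where xy: "z = (x, y)" "x \<in> topspace X" "y \<in> topspace X" "x \<noteq> y" by auto
    have "closedin X {y}"
      using Hausdorff_imp_t1_space[OF H] xy(3) by (simp add: closedin_t1_singleton)
    then obtain f :: "'a \<Rightarrow> real" where "continuous_map X (top_of_set {0..1}) f" "f x = 0" "f ` {y} \<subseteq> {1}"
      using cr xy unfolding completely_regular_space_def by blast
    then have "f \<in> \<G>" "z \<in> nz f"
      unfolding \<G>_def nz_def using xy by (auto simp: continuous_map_in_subtopology)
    then show "z \<in> \<Union>(nz ` \<G>)" by blast
  qed
  have "topspace ?XX - ?C = ?\<Delta>" by auto
  then have "fsigma_in ?XX ?C"
    using G unfolding fsigma_in_gdelta_in by (metis Diff_subset)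
  moreover have "Lindelof_space ?XX"
    using K by (simp add: compact_imp_Lindelof_space compact_space_prod_topology)
  ultimately have "Lindelof_space (subtopology ?XX ?C)"
    by (intro Lindelof_space_fsigma_subtopology)
  then have "(\<forall>U\<in>nz ` \<G>. openin ?XX U) \<and> ?C \<subseteq> \<Union>(nz ` \<G>) \<longrightarrow>
      (\<exists>\<V>. countable \<V> \<and> \<V> \<subseteq> nz ` \<G> \<and> ?C \<subseteq> \<Union>\<V>)"
    unfolding Lindelof_space_subtopology_subset[OF Diff_subset] by (rule spec)
  moreover have "\<forall>U\<in>nz ` \<G>. openin ?XX U"
    using op by simp
  ultimately obtain \<V> where \<V>: "countable \<V>" "\<V> \<subseteq> nz ` \<G>" "?C \<subseteq> \<Union>\<V>"
    using cover by meson
  obtain \<F> where \<F>: "countable \<F>" "\<F> \<subseteq> \<G>" "\<V> = nz ` \<F>"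
    using \<V>(1,2) by (metis countable_subset_image)
  let ?R = "product_topology (\<lambda>_. euclideanreal) \<F>" and ?e = "\<lambda>x. restrict (\<lambda>f. f x) \<F>"
  have "continuous_map X ?R ?e"
    using \<F>(2) by (auto simp: continuous_map_componentwise \<G>_def)
  moreover have "inj_on ?e (topspace X)"
  proof (intro inj_onI, rule ccontr)
    fix x y assume xy: "x \<in> topspace X" "y \<in> topspace X" "?e x = ?e y" "x \<noteq> y"
    then have "(x, y) \<in> ?C" by auto
    then obtain f where "f \<in> \<F>" "(x, y) \<in> nz f" using \<V>(3) \<F>(3) by blast
    then show False using fun_cong[OF xy(3), of f] unfolding nz_def by simp
  qed
  ultimately have "embedding_map X ?R ?e"
    using K by (intro continuous_imp_embedding_map) (auto simp: Hausdorff_space_product_topology)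
  then have "X homeomorphic_space subtopology ?R (?e ` topspace X)"
    by (rule embedding_map_imp_homeomorphic_space)
  moreover have "metrizable_space ?R"
    using \<F>(1) by (auto simp: metrizable_space_product_topology metrizable_space_euclidean
        intro: countable_subset)
  ultimately show ?thesis
    using homeomorphic_metrizable_space metrizable_space_subtopology by blast
qed

theorem gdelta_in_Id_on_iff:
  assumes K: "compact_space X" and H: "Hausdorff_space X" and S: "closedin X S"
  shows "gdelta_in (prod_topology X X) (Id_on S) \<longleftrightarrow>
           gdelta_in X S \<and> metrizable_space (subtopology X S)"
proof -
  have SS: "S \<subseteq> topspace X" using S by (rule closedin_subset)
  then have top: "topspace (subtopology X S) = S" by (rule topspace_subtopology_subset)
  have prod: "prod_topology (subtopology X S) (subtopology X S) = subtopology (prod_topology X X) (S \<times> S)"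
    by (simp add: subtopology_Times)
  have HS: "Hausdorff_space (subtopology X S)" using H by (rule Hausdorff_space_subtopology)
  show ?thesis
  proof (intro iffI conjI; (elim conjE)?)
    assume G: "gdelta_in (prod_topology X X) (Id_on S)"
    have "continuous_map X (prod_topology X X) (\<lambda>x. (x, x))"
      by (simp add: continuous_map_paired)
    from gdelta_in_continuous_map_preimage[OF this G]
    have "gdelta_in X {x \<in> topspace X. (x, x) \<in> Id_on S}" .
    moreover have "{x \<in> topspace X. (x, x) \<in> Id_on S} = S" using SS by auto
    ultimately show "gdelta_in X S" by simp
    have "compact_space (subtopology X S)"
      using K S closedin_compact_space compact_space_subtopology by blast
    moreover have "Id_on S = Id_on S \<inter> S \<times> S" by auto
    then have "gdelta_in (prod_topology (subtopology X S) (subtopology X S)) (Id_on S)"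
      unfolding prod gdelta_in_subtopology using G by blast
    ultimately show "metrizable_space (subtopology X S)"
      using HS compact_Hausdorff_gdelta_diagonal_imp_metrizable top by metis
  next
    assume G: "gdelta_in X S" and M: "metrizable_space (subtopology X S)"
    have "Id_on S = (\<lambda>x. (x, x)) ` S" by auto
    then have "closedin (prod_topology (subtopology X S) (subtopology X S)) (Id_on S)"
      using HS unfolding Hausdorff_space_closedin_diagonal top by simp
    moreover have "metrizable_space (prod_topology (subtopology X S) (subtopology X S))"
      using M by (simp add: metrizable_space_prod_topology)
    ultimately have "gdelta_in (subtopology (prod_topology X X) (S \<times> S)) (Id_on S)"
      using closed_imp_gdelta_in unfolding prod by blast
    then show "gdelta_in (prod_topology X X) (Id_on S)"
      using gdelta_in_gdelta_subtopology[OF gdelta_in_Times[OF G G]] by blast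
  qed
qed

section \<open>Uniformities that are countably based along a set\<close>

text \<open>
  The traces on \<open>D \<times> UNIV\<close> of the entourages in \<open>\<UU>\<close> have a countable base. Only the first
  coordinate is restricted: the condition speaks of uniform neighbourhoods in the whole space of
  the points of \<open>D\<close>, and is stronger than countability of the uniformity induced on \<open>D\<close>.
\<close>
definition countably_based_along :: "('a \<times> 'a) set set \<Rightarrow> 'a set \<Rightarrow> bool" where
  "countably_based_along \<UU> D \<longleftrightarrow>
     (\<exists>\<C>\<subseteq>\<UU>. countable \<C> \<and> (\<forall>U\<in>\<UU>. \<exists>V\<in>\<C>. V \<inter> D \<times> UNIV \<subseteq> U))"

theorem first_countable_power_iff:
  assumes u: "is_uniformity S \<UU>"
  shows "first_countable (uniform_topology (UNIV \<rightarrow> S)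
             (uniformity_from_base (UNIV \<rightarrow> S) (power_entourage S ` \<UU>)))
         \<longleftrightarrow> (\<forall>f\<in>UNIV \<rightarrow> S. countably_based_along \<UU> (range (f :: nat \<Rightarrow> 'a)))"
    (is "first_countable ?T \<longleftrightarrow> _")
proof -
  let ?P = "UNIV \<rightarrow> S :: (nat \<Rightarrow> 'a) set" and ?E = "power_entourage S"
  let ?\<VV> = "uniformity_from_base ?P (?E ` \<UU>)"
  have v: "is_uniformity ?P ?\<VV>" using u by (rule is_uniformity_power)
  have top: "topspace ?T = ?P" using v by (rule topspace_uniform_topology)
  have sub: "?E U \<subseteq> ?P \<times> ?P" for U unfolding power_entourage_def by auto
  have nbhd: "\<exists>U\<in>\<UU>. ?E U `` {f} \<subseteq> W" if W: "openin ?T W" "f \<in> W" for f W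
  proof -
    obtain E where "E \<in> ?\<VV>" "E `` {f} \<subseteq> W"
      using W unfolding openin_uniform_topology[OF v] by blast
    then show ?thesis unfolding uniformity_from_base_def by blast
  qed
  have basic: "\<exists>N. openin ?T N \<and> f \<in> N \<and> N \<subseteq> ?E U `` {f}" if "U \<in> \<UU>" "f \<in> ?P" for U f
  proof -
    have "?E U \<in> ?\<VV>" unfolding uniformity_from_base_def using that(1) sub by blast
    from uniform_nbhd[OF v this that(2)] show ?thesis by metis
  qed
  show ?thesis
  proof (intro iffI ballI)
    fix f assume fc: "first_countable ?T" and f: "f \<in> ?P"
    obtain \<B> where \<B>: "countable \<B>" "\<And>B. B \<in> \<B> \<Longrightarrow> openin ?T B"
      "\<And>W. openin ?T W \<and> f \<in> W \<Longrightarrow> \<exists>B\<in>\<B>. f \<in> B \<and> B \<subseteq> W"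
      using fc f unfolding first_countable_def top by metis
    have "\<forall>B\<in>{B \<in> \<B>. f \<in> B}. \<exists>U\<in>\<UU>. ?E U `` {f} \<subseteq> B"
      using nbhd \<B>(2) by blast
    then obtain U where U: "\<And>B. B \<in> \<B> \<Longrightarrow> f \<in> B \<Longrightarrow> U B \<in> \<UU> \<and> ?E (U B) `` {f} \<subseteq> B"
      by (metis (mono_tags, lifting) mem_Collect_eq)
    have "\<exists>V\<in>U ` {B \<in> \<B>. f \<in> B}. V \<inter> range f \<times> UNIV \<subseteq> D" if D: "D \<in> \<UU>" for D
    proof -
      obtain N where N: "openin ?T N" "f \<in> N" "N \<subseteq> ?E D `` {f}" using basic[OF D f] by blast
      then obtain B where B: "B \<in> \<B>" "f \<in> B" "B \<subseteq> N" using \<B>(3) by blast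
      have "(f k, y) \<in> D" if y: "(f k, y) \<in> U B" for k y
      proof -
        have UB: "U B \<in> \<UU>" using U B by blast
        have "y \<in> S" using y is_uniformityD(2)[OF u UB] by blast
        \<comment> \<open>Changing \<open>f\<close> at the single index \<open>k\<close> isolates the pair \<open>(f k, y)\<close>.\<close>
        then have "(f, f(k := y)) \<in> ?E (U B)"
          using f y is_uniformityD(3)[OF u UB] unfolding power_entourage_def by auto
        then have "(f, f(k := y)) \<in> ?E D" using U[OF B(1,2)] B(3) N(3) by blast
        then have "(f k, (f(k := y)) k) \<in> D" unfolding power_entourage_def by blast
        then show ?thesis by simp
      qed
      then have "U B \<inter> range f \<times> UNIV \<subseteq> D" by auto
      then show ?thesis using B by blast
    qed
    moreover have "U ` {B \<in> \<B>. f \<in> B} \<subseteq> \<UU>" using U by blast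
    moreover have "countable (U ` {B \<in> \<B>. f \<in> B})" using \<B>(1) by simp
    ultimately show "countably_based_along \<UU> (range f)"
      unfolding countably_based_along_def by blast
  next
    assume r: "\<forall>f\<in>?P. countably_based_along \<UU> (range f)"
    show "first_countable ?T"
      unfolding first_countable_def top
    proof
      fix f assume f: "f \<in> ?P"
      obtain \<C> where \<C>: "\<C> \<subseteq> \<UU>" "countable \<C>"
        "\<And>U. U \<in> \<UU> \<Longrightarrow> \<exists>V\<in>\<C>. V \<inter> range f \<times> UNIV \<subseteq> U"
        using r f unfolding countably_based_along_def by meson
      have "\<forall>V\<in>\<C>. \<exists>N. openin ?T N \<and> f \<in> N \<and> N \<subseteq> ?E V `` {f}"
        using basic f \<C>(1) by blast
      then obtain N where N: "\<And>V. V \<in> \<C> \<Longrightarrow> openin ?T (N V) \<and> f \<in> N V \<and> N V \<subseteq> ?E V `` {f}"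
        by metis
      have "\<exists>B\<in>N ` \<C>. f \<in> B \<and> B \<subseteq> W" if W: "openin ?T W" "f \<in> W" for W
      proof -
        obtain U where U: "U \<in> \<UU>" "?E U `` {f} \<subseteq> W" using nbhd[OF W] by blast
        obtain V where V: "V \<in> \<C>" "V \<inter> range f \<times> UNIV \<subseteq> U" using \<C>(3)[OF U(1)] by blast
        have "?E V `` {f} \<subseteq> ?E U `` {f}" using V(2) unfolding power_entourage_def by auto
        then show ?thesis using N[OF V(1)] V(1) U(2) by blast
      qed
      then show "\<exists>\<B>. countable \<B> \<and> (\<forall>B\<in>\<B>. openin ?T B) \<and>
          (\<forall>W. openin ?T W \<and> f \<in> W \<longrightarrow> (\<exists>B\<in>\<B>. f \<in> B \<and> B \<subseteq> W))"
        using \<C>(2) N by (intro exI[of _ "N ` \<C>"]) auto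
    qed
  qed
qed

text \<open>
  The set \<open>D\<close> is arbitrary here; in particular it may be uncountable. The \<open>G\<^sub>\<delta>\<close> condition takes place
  in \<open>X \<times> X\<close>, so it restricts the position of the closure of \<open>D\<close> in \<open>X\<close> and not only its own topology.
\<close>
theorem countably_based_along_iff_gdelta_diagonal:
  assumes K: "compact_space X" and H: "Hausdorff_space X" and c: "compatible_uniformity X \<UU>"
    and D: "D \<subseteq> topspace X"
  shows "countably_based_along \<UU> D \<longleftrightarrow> gdelta_in (prod_topology X X) (Id_on (X closure_of D))"
proof -
  let ?S = "X closure_of D" and ?XX = "prod_topology X X"
  have u: "is_uniformity (topspace X) \<UU>" and X: "uniform_topology (topspace X) \<UU> = X"
    using c unfolding compatible_uniformity_def by auto
  have op: "openin X A \<longleftrightarrow> A \<subseteq> topspace X \<and> (\<forall>x\<in>A. \<exists>U\<in>\<UU>. U `` {x} \<subseteq> A)" for A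
    using openin_uniform_topology[OF u] X by simp
  have STS: "?S \<subseteq> topspace X" by (rule closure_of_subset_topspace)
  show ?thesis
  proof
    assume "countably_based_along \<UU> D"
    then obtain \<C> where \<C>: "\<C> \<subseteq> \<UU>" "countable \<C>"
      "\<And>U. U \<in> \<UU> \<Longrightarrow> \<exists>V\<in>\<C>. V \<inter> D \<times> UNIV \<subseteq> U"
      unfolding countably_based_along_def by meson
    have ne: "\<C> \<noteq> {}" using \<C>(3) is_uniformityD(1)[OF u] by blast
    have "\<forall>V\<in>\<C>. \<exists>W. openin ?XX W \<and> Id_on (topspace X) \<subseteq> W \<and> W \<subseteq> V"
      using compatible_uniformity_subset_nbhds[OF c] \<C>(1) by blast
    then obtain W where W: "\<And>V. V \<in> \<C> \<Longrightarrow> openin ?XX (W V) \<and> Id_on (topspace X) \<subseteq> W V \<and> W V \<subseteq> V"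
      by metis
    \<comment> \<open>\<open>G V\<close> collects the pairs whose coordinates are both \<open>W V\<close>-close to one point of \<open>D\<close>.
      Density of \<open>D\<close> puts the diagonal of the closure into each \<open>G V\<close>, and the traces of the \<open>V\<close>
      being a base leaves nothing else in the intersection.\<close>
    define G where "G V = (\<Union>d\<in>D. (W V `` {d}) \<times> (W V `` {d}))" for V
    have slice: "openin X (W V `` {d})" "openin X ((W V)\<inverse> `` {d})"
      if "V \<in> \<C>" "d \<in> topspace X" for V d
    proof -
      have "continuous_map X ?XX (\<lambda>y. (d, y))" "continuous_map X ?XX (\<lambda>y. (y, d))"
        using that(2) by (auto simp: continuous_map_paired)
      from this[THEN openin_continuous_map_preimage, of "W V"]
      have "openin X {y \<in> topspace X. (d, y) \<in> W V}" "openin X {y \<in> topspace X. (y, d) \<in> W V}"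
        using W that(1) by auto
      moreover have "{y \<in> topspace X. (d, y) \<in> W V} = W V `` {d}"
        "{y \<in> topspace X. (y, d) \<in> W V} = (W V)\<inverse> `` {d}"
        using openin_subset[of ?XX "W V"] W[OF that(1)] by auto
      ultimately show "openin X (W V `` {d})" "openin X ((W V)\<inverse> `` {d})" by simp_all
    qed
    have "openin ?XX (G V)" if "V \<in> \<C>" for V
      unfolding G_def using slice(1)[OF that] D
      by (intro openin_Union) (auto simp: openin_prod_Times_iff)
    then have "gdelta_in ?XX (\<Inter>V\<in>\<C>. G V)"
      using \<C>(2) ne by (intro gdelta_in_INT_openin)
    moreover have "(\<Inter>V\<in>\<C>. G V) = Id_on ?S"
    proof (intro subset_antisym subsetI)
      fix z assume z: "z \<in> (\<Inter>V\<in>\<C>. G V)"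
      obtain a b where ab: "z = (a, b)" by force
      have near: "\<exists>d\<in>D. (d, a) \<in> U \<and> (d, b) \<in> U" if U: "U \<in> \<UU>" for U
      proof -
        obtain V where V: "V \<in> \<C>" "V \<inter> D \<times> UNIV \<subseteq> U" using \<C>(3)[OF U] by blast
        then obtain d where "d \<in> D" "(d, a) \<in> W V" "(d, b) \<in> W V" using z ab unfolding G_def by blast
        then show ?thesis using W[OF V(1)] V(2) by blast
      qed
      have in_top: "a \<in> topspace X" "b \<in> topspace X"
        using near[OF is_uniformityD(1)[OF u]] by auto
      have "a \<in> ?S"
        unfolding in_closure_of
      proof (intro conjI allI impI)
        fix T assume "a \<in> T \<and> openin X T"
        then obtain U where U: "U \<in> \<UU>" "U `` {a} \<subseteq> T" using op by blast
        from near[OF is_uniformityD(6)[OF u U(1)]]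
        show "\<exists>y. y \<in> D \<and> y \<in> T" using U(2) by blast
      qed (rule in_top)
      moreover have "a = b"
      proof (rule ccontr)
        assume ne: "a \<noteq> b"
        have "openin X (topspace X - {b})"
          using H in_top(2) Hausdorff_imp_t1_space t1_space_openin_delete_alt openin_topspace by metis
        moreover have "a \<in> topspace X - {b}" using ne in_top(1) by simp
        ultimately obtain U where U: "U \<in> \<UU>" "U `` {a} \<subseteq> topspace X - {b}" unfolding op by blast
        obtain V where V: "V \<in> \<UU>" "V O V \<subseteq> U" using is_uniformityD(7)[OF u U(1)] by blast
        have "V \<inter> V\<inverse> \<in> \<UU>" using V(1) is_uniformityD(5,6)[OF u] by blast
        from near[OF this] have "(a, b) \<in> U" using V(2) by blast
        then show False using U(2) by blast
      qed
      ultimately show "z \<in> Id_on ?S" using ab by auto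
    next
      fix z assume "z \<in> Id_on ?S"
      then obtain a where a: "z = (a, a)" "a \<in> ?S" by auto
      then have aT: "a \<in> topspace X" using STS by blast
      have "z \<in> G V" if V: "V \<in> \<C>" for V
      proof -
        have "a \<in> (W V)\<inverse> `` {a}" using W[OF V] aT by blast
        moreover have "\<forall>T. a \<in> T \<and> openin X T \<longrightarrow> (\<exists>d. d \<in> D \<and> d \<in> T)"
          using a(2) unfolding in_closure_of by (rule conjunct2)
        ultimately obtain d where "d \<in> D" "d \<in> (W V)\<inverse> `` {a}"
          using slice(2)[OF V aT] by meson
        then have "d \<in> D" "(d, a) \<in> W V" by auto
        then show ?thesis unfolding G_def a(1) by blast
      qed
      then show "z \<in> (\<Inter>V\<in>\<C>. G V)" by blast
    qed
    ultimately show "gdelta_in ?XX (Id_on ?S)" by simp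
  next
    assume G: "gdelta_in ?XX (Id_on ?S)"
    have KK: "compact_space ?XX" "Hausdorff_space ?XX"
      using K H by (simp_all add: compact_space_prod_topology Hausdorff_space_prod_topology)
    have "Id_on ?S = ?S \<times> ?S \<inter> (\<lambda>x. (x, x)) ` topspace X" using STS by auto
    then have "closedin ?XX (Id_on ?S)"
      using H unfolding Hausdorff_space_closedin_diagonal
      by (simp add: closedin_Int closedin_prod_Times_iff)
    from compact_Hausdorff_gdelta_imp_countable_nbhd_base[OF KK this G]
    obtain \<N> where \<N>: "countable \<N>" "\<And>N. N \<in> \<N> \<Longrightarrow> openin ?XX N \<and> Id_on ?S \<subseteq> N"
      "\<And>V. openin ?XX V \<Longrightarrow> Id_on ?S \<subseteq> V \<Longrightarrow> \<exists>N\<in>\<N>. N \<subseteq> V"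
      by metis
    \<comment> \<open>The added pairs make \<open>E N\<close> contain the whole diagonal without changing its trace on \<open>?S \<times> UNIV\<close>.\<close>
    define E where "E N = N \<union> (topspace X - ?S) \<times> topspace X" for N
    have "E N \<in> \<UU>" if N: "N \<in> \<N>" for N
    proof (rule compatible_uniformity_supset_nbhds[OF K c _ _ subset_refl])
      show o: "openin ?XX (E N)"
        unfolding E_def using \<N>(2)[OF N]
        by (intro openin_Un) (auto simp: openin_prod_Times_iff)
      show "Id_on (topspace X) \<subseteq> E N" unfolding E_def using \<N>(2)[OF N] by blast
      show "E N \<subseteq> topspace X \<times> topspace X" using openin_subset[OF o] by simp
    qed
    then have "E ` \<N> \<subseteq> \<UU>" by blast
    moreover have "\<exists>V\<in>E ` \<N>. V \<inter> D \<times> UNIV \<subseteq> U" if U: "U \<in> \<UU>" for U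
    proof -
      obtain W where W: "openin ?XX W" "Id_on (topspace X) \<subseteq> W" "W \<subseteq> U"
        using compatible_uniformity_subset_nbhds[OF c U] by blast
      then have "Id_on ?S \<subseteq> W" using STS by blast
      then obtain N where N: "N \<in> \<N>" "N \<subseteq> W" using \<N>(3) W(1) by blast
      have "E N \<inter> D \<times> UNIV \<subseteq> U"
        using N(2) W(3) closure_of_subset[OF D] unfolding E_def by blast
      then show ?thesis using N(1) by blast
    qed
    ultimately show "countably_based_along \<UU> D"
      unfolding countably_based_along_def using \<N>(1) by (intro exI[of _ "E ` \<N>"]) simp
  qed
qed

section \<open>Separable closed subspaces\<close>

lemma separable_subtopology_iff:
  "S \<subseteq> topspace X \<Longrightarrow> separable_space (subtopology X S) \<longleftrightarrow>
     (\<exists>D. countable D \<and> D \<subseteq> S \<and> S \<subseteq> X closure_of D)"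
  unfolding separable_space_def topspace_subtopology_subset closure_of_subtopology
  by (intro ex_cong1) (auto simp: closure_of_subtopology Int_absorb1)

lemma separable_space_closure_of:
  assumes "S \<subseteq> topspace X" "separable_space (subtopology X S)"
  shows "separable_space (subtopology X (X closure_of S))"
proof -
  obtain D where D: "countable D" "D \<subseteq> S" "S \<subseteq> X closure_of D"
    using assms separable_subtopology_iff by metis
  then have "X closure_of S \<subseteq> X closure_of D" by (simp add: closure_of_minimal)
  moreover have "D \<subseteq> X closure_of S" using D(2) closure_of_subset[OF assms(1)] by blast
  ultimately show ?thesis
    using D(1) separable_subtopology_iff[OF closure_of_subset_topspace] by blast
qed

lemma omega_monolithic_iff_closed:
  "omega_monolithic X \<longleftrightarrow>
     (\<forall>S. closedin X S \<and> separable_space (subtopology X S) \<longrightarrow> metrizable_space (subtopology X S))"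
proof (intro iffI allI impI)
  fix S assume "omega_monolithic X" "closedin X S \<and> separable_space (subtopology X S)"
  then show "metrizable_space (subtopology X S)"
    unfolding omega_monolithic_def using closedin_subset by blast
next
  assume r: "\<forall>S. closedin X S \<and> separable_space (subtopology X S) \<longrightarrow> metrizable_space (subtopology X S)"
  show "omega_monolithic X"
    unfolding omega_monolithic_def
  proof (intro allI impI, elim conjE)
    fix S assume S: "S \<subseteq> topspace X" "separable_space (subtopology X S)"
    have "metrizable_space (subtopology (subtopology X (X closure_of S)) S)"
      by (intro metrizable_space_subtopology r[rule_format] conjI closedin_closure_of
          separable_space_closure_of[OF S])
    then show "metrizable_space (subtopology X S)"
      using closure_of_subset[OF S(1)] by (simp add: subtopology_subtopology Int_absorb1)
  qed
qed

text \<open>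
  The nonempty closed separable subspaces are exactly the closures of the ranges of sequences.
  The empty one is not of this form, whence the assumption on \<open>P\<close>; it also covers empty \<open>X\<close>.
\<close>
lemma all_closure_of_range_iff:
  assumes "P {}"
  shows "(\<forall>f\<in>UNIV \<rightarrow> topspace X. P (X closure_of range (f :: nat \<Rightarrow> 'a))) \<longleftrightarrow>
           (\<forall>S. closedin X S \<and> separable_space (subtopology X S) \<longrightarrow> P S)"
proof (intro iffI allI impI ballI)
  fix f :: "nat \<Rightarrow> 'a"
  assume r: "\<forall>S. closedin X S \<and> separable_space (subtopology X S) \<longrightarrow> P S"
    and "f \<in> UNIV \<rightarrow> topspace X"
  then have f: "range f \<subseteq> topspace X" by auto
  have "separable_space (subtopology X (X closure_of range f))"
    unfolding separable_subtopology_iff[OF closure_of_subset_topspace]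
    using closure_of_subset[OF f] by (intro exI[of _ "range f"]) simp
  then show "P (X closure_of range f)" using r by simp
next
  fix S
  assume r: "\<forall>f\<in>UNIV \<rightarrow> topspace X. P (X closure_of range (f :: nat \<Rightarrow> 'a))"
    and S: "closedin X S \<and> separable_space (subtopology X S)"
  then have sub: "S \<subseteq> topspace X" using closedin_subset by blast
  obtain D where D: "countable D" "D \<subseteq> S" "S \<subseteq> X closure_of D"
    using S separable_subtopology_iff[OF sub] by blast
  show "P S"
  proof (cases "D = {}")
    case True
    then show ?thesis using D(3) assms by simp
  next
    case False
    then obtain f :: "nat \<Rightarrow> 'a" where f: "range f = D"
      using D(1) by (metis uncountable_def)
    then have "P (X closure_of D)" using r D(2) sub by blast
    moreover have "X closure_of D = S"
      using D S by (simp add: closure_of_minimal subset_antisym)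
    ultimately show ?thesis by simp
  qed
qed

theorem theorem4p3:
  fixes X :: "'a topology"
  assumes "compact_space X" and "Hausdorff_space X"
  shows "first_countable (uniform_power X) \<longleftrightarrow>
           omega_monolithic X \<and>
           (\<forall>S. closedin X S \<and> separable_space (subtopology X S) \<longrightarrow> gdelta_in X S)"
proof -
  let ?XX = "prod_topology X X"
  have c: "compatible_uniformity X (the_uniformity X)"
    using assms by (rule compatible_the_uniformity)
  then have u: "is_uniformity (topspace X) (the_uniformity X)"
    unfolding compatible_uniformity_def by blast
  have "first_countable (uniform_power X) \<longleftrightarrow>
      (\<forall>f\<in>UNIV \<rightarrow> topspace X. countably_based_along (the_uniformity X) (range (f :: nat \<Rightarrow> 'a)))"
    unfolding uniform_power_def using u by (rule first_countable_power_iff)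
  also have "\<dots> \<longleftrightarrow>
      (\<forall>f\<in>UNIV \<rightarrow> topspace X. gdelta_in ?XX (Id_on (X closure_of range (f :: nat \<Rightarrow> 'a))))"
  proof (rule ball_cong[OF refl])
    fix f :: "nat \<Rightarrow> 'a" assume "f \<in> UNIV \<rightarrow> topspace X"
    then have "range f \<subseteq> topspace X" by auto
    then show "countably_based_along (the_uniformity X) (range f) \<longleftrightarrow>
        gdelta_in ?XX (Id_on (X closure_of range f))"
      by (rule countably_based_along_iff_gdelta_diagonal[OF assms c])
  qed
  also have "\<dots> \<longleftrightarrow> (\<forall>S. closedin X S \<and> separable_space (subtopology X S) \<longrightarrow> gdelta_in ?XX (Id_on S))"
    by (rule all_closure_of_range_iff) simp
  also have "\<dots> \<longleftrightarrow> (\<forall>S. closedin X S \<and> separable_space (subtopology X S) \<longrightarrow>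
      gdelta_in X S \<and> metrizable_space (subtopology X S))"
    using gdelta_in_Id_on_iff[OF assms] by blast
  also have "\<dots> \<longleftrightarrow> omega_monolithic X \<and>
      (\<forall>S. closedin X S \<and> separable_space (subtopology X S) \<longrightarrow> gdelta_in X S)"
    unfolding omega_monolithic_iff_closed by blast
  finally show ?thesis .
qed

end
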